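(* Let $\hbar,m>0$ be real constants, let $V:\mathbb{R}^2\to\mathbb{R}$, let $\alpha,\beta,\gamma,\delta:\mathbb{R}^2\to\mathbb{R}$ be smooth functions of $(x,t)$, and let $\psi=\mathrm{e}^{\alpha+\beta\mathbf{i_1}+\gamma\mathbf{i_2}+\delta\mathbf{j}}:\mathbb{R}^2\to\mathbb{T}$. (1) If $\psi$ satisfies the bicomplex Schrödinger equation $$\mathbf{i_1}\hbar\,\partial_t\psi+\frac{\hbar^2}{2m}\partial_x^2\psi-V\psi=0,$$ then the following four continuity equations hold: $$\partial_t(\psi\psi^{\dag_1})+\partial_xJ_1=0,\quad \partial_t(\psi\psi^{\dag_3})+\partial_xJ_2=0,\quad \partial_t(\psi^{\dag_2}\psi^{\dag_1})+\partial_xJ_3=0,\quad \partial_t(\psi^{\dag_2}\psi^{\dag_3})+\partial_xJ_4=0,$$ where $$J_1=\frac{\hbar}{2m\mathbf{i_1}}(\psi^{\dag_1}\partial_x\psi-\psi\,\partial_x\psi^{\dag_1})=\frac{\hbar}{m}\mathrm{e}^{2(\alpha+\gamma\mathbf{i_2})}\partial_x(\beta+\delta\mathbf{i_2}),$$ $$J_2=\frac{\hbar}{2m\mathbf{i_1}}(\psi^{\dag_3}\partial_x\psi-\psi\,\partial_x\psi^{\dag_3})=\frac{\hbar}{m}\mathrm{e}^{2(\alpha+\delta\mathbf{j})}\partial_x(\beta-\gamma\mathbf{j}),$$ $$J_3=\frac{\hbar}{2m\mathbf{i_1}}(\psi^{\dag_1}\partial_x\psi^{\dag_2}-\psi^{\dag_2}\partial_x\psi^{\dag_1})=\frac{\hbar}{m}\mathrm{e}^{2(\alpha-\delta\mathbf{j})}\partial_x(\beta+\gamma\mathbf{j}),$$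 $$J_4=\frac{\hbar}{2m\mathbf{i_1}}(\psi^{\dag_3}\partial_x\psi^{\dag_2}-\psi^{\dag_2}\partial_x\psi^{\dag_3})=\frac{\hbar}{m}\mathrm{e}^{2(\alpha-\gamma\mathbf{i_2})}\partial_x(\beta-\delta\mathbf{i_2}).$$ Moreover $J_4=(J_1)^{\dag_2}$ and $J_3=(J_2)^{\dag_1}$; the fourth continuity equation is the $\dag_2$-conjugate of the first, and the third is the $\dag_1$-conjugate of the second. (2) Consider the real equations $$(A)\quad \partial_t\alpha+\frac{\hbar}{2m}\left[\partial_x^2\beta+2(\partial_x\alpha\,\partial_x\beta-\partial_x\gamma\,\partial_x\delta)\right]=0,$$ $$(B)\quad -\partial_t\delta+\frac{\hbar}{2m}\left[\partial_x^2\gamma+2(\partial_x\alpha\,\partial_x\gamma-\partial_x\beta\,\partial_x\delta)\right]=0,$$ $$(C)\quad \partial_t\gamma+\frac{\hbar}{2m}\left[\partial_x^2\delta+2(\partial_x\alpha\,\partial_x\delta+\partial_x\beta\,\partial_x\gamma)\right]=0.$$ The continuity equation $\partial_t(\psi\psi^{\dag_1})+\partial_xJ_1=0$ is equivalent to (A) and (C) together, and the continuity equation $\partial_t(\psi\psi^{\dag_3})+\partial_xJ_2=0$ is equivalent to (A) and (B) together. Hence the system (A), (B), (C) is equivalent to these two continuity equations together.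
   Context: The bicomplex numbers are the commutative ring $\mathbb{T}=\{w_0+w_1\mathbf{i_1}+w_2\mathbf{i_2}+w_3\mathbf{j}: w_0,\dots,w_3\in\mathbb{R}\}$ with $\mathbf{i_1}^2=\mathbf{i_2}^2=-1$, $\mathbf{j}^2=1$, $\mathbf{i_1}\mathbf{i_2}=\mathbf{i_2}\mathbf{i_1}=\mathbf{j}$, $\mathbf{i_1}\mathbf{j}=\mathbf{j}\mathbf{i_1}=-\mathbf{i_2}$, $\mathbf{i_2}\mathbf{j}=\mathbf{j}\mathbf{i_2}=-\mathbf{i_1}$. The three conjugations of $w=w_0+w_1\mathbf{i_1}+w_2\mathbf{i_2}+w_3\mathbf{j}$ are $w^{\dag_1}=w_0-w_1\mathbf{i_1}+w_2\mathbf{i_2}-w_3\mathbf{j}$, $w^{\dag_2}=w_0+w_1\mathbf{i_1}-w_2\mathbf{i_2}-w_3\mathbf{j}$, $w^{\dag_3}=w_0-w_1\mathbf{i_1}-w_2\mathbf{i_2}+w_3\mathbf{j}$. The exponential $\mathrm{e}^w$ is the usual power series in the (finite-dimensional real) algebra $\mathbb{T}$. Derivatives of $\mathbb{T}$-valued functions of the real variables $(x,t)$ are taken componentwise, and conjugates of functions pointwise. *)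

theory Defs
  imports "HOL-Analysis.Analysis"
begin

text \<open>
  \<open>Bicomplex a b c d\<close> is \<open>a + b i1 + c i2 + d j\<close>; see \<open>bicomplex_expand\<close> and the multiplication
  table \<open>unit_products\<close> below.
\<close>

datatype bicomplex = Bicomplex (bc0: real) (bc1: real) (bc2: real) (bc3: real)

lemma bicomplex_eq_iff:
  "x = y \<longleftrightarrow> bc0 x = bc0 y \<and> bc1 x = bc1 y \<and> bc2 x = bc2 y \<and> bc3 x = bc3 y"
  by (auto intro: bicomplex.expand)

instantiation bicomplex :: comm_ring_1
begin

definition zero_bicomplex :: bicomplex where "0 = Bicomplex 0 0 0 0"
definition one_bicomplex :: bicomplex where "1 = Bicomplex 1 0 0 0"
definition plus_bicomplex :: "bicomplex \<Rightarrow> bicomplex \<Rightarrow> bicomplex" where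
  "x + y = Bicomplex (bc0 x + bc0 y) (bc1 x + bc1 y) (bc2 x + bc2 y) (bc3 x + bc3 y)"
definition uminus_bicomplex :: "bicomplex \<Rightarrow> bicomplex" where
  "- x = Bicomplex (- bc0 x) (- bc1 x) (- bc2 x) (- bc3 x)"
definition minus_bicomplex :: "bicomplex \<Rightarrow> bicomplex \<Rightarrow> bicomplex" where
  "x - y = Bicomplex (bc0 x - bc0 y) (bc1 x - bc1 y) (bc2 x - bc2 y) (bc3 x - bc3 y)"
definition times_bicomplex :: "bicomplex \<Rightarrow> bicomplex \<Rightarrow> bicomplex" where
  "x * y = Bicomplex
     (bc0 x * bc0 y - bc1 x * bc1 y - bc2 x * bc2 y + bc3 x * bc3 y)
     (bc0 x * bc1 y + bc1 x * bc0 y - bc2 x * bc3 y - bc3 x * bc2 y)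
     (bc0 x * bc2 y + bc2 x * bc0 y - bc1 x * bc3 y - bc3 x * bc1 y)
     (bc0 x * bc3 y + bc3 x * bc0 y + bc1 x * bc2 y + bc2 x * bc1 y)"

instance
  by standard
    (auto simp: bicomplex_eq_iff zero_bicomplex_def one_bicomplex_def plus_bicomplex_def
      uminus_bicomplex_def minus_bicomplex_def times_bicomplex_def algebra_simps)

end

lemma bc_ring_simps [simp]:
  "bc0 0 = 0" "bc1 0 = 0" "bc2 0 = 0" "bc3 0 = 0"
  "bc0 1 = 1" "bc1 1 = 0" "bc2 1 = 0" "bc3 1 = 0"
  "bc0 (x + y) = bc0 x + bc0 y" "bc1 (x + y) = bc1 x + bc1 y"
  "bc2 (x + y) = bc2 x + bc2 y" "bc3 (x + y) = bc3 x + bc3 y"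
  "bc0 (- x) = - bc0 x" "bc1 (- x) = - bc1 x" "bc2 (- x) = - bc2 x" "bc3 (- x) = - bc3 x"
  "bc0 (x - y) = bc0 x - bc0 y" "bc1 (x - y) = bc1 x - bc1 y"
  "bc2 (x - y) = bc2 x - bc2 y" "bc3 (x - y) = bc3 x - bc3 y"
  "bc0 (x * y) = bc0 x * bc0 y - bc1 x * bc1 y - bc2 x * bc2 y + bc3 x * bc3 y"
  "bc1 (x * y) = bc0 x * bc1 y + bc1 x * bc0 y - bc2 x * bc3 y - bc3 x * bc2 y"
  "bc2 (x * y) = bc0 x * bc2 y + bc2 x * bc0 y - bc1 x * bc3 y - bc3 x * bc1 y"
  "bc3 (x * y) = bc0 x * bc3 y + bc3 x * bc0 y + bc1 x * bc2 y + bc2 x * bc1 y"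
  by (simp_all add: zero_bicomplex_def one_bicomplex_def plus_bicomplex_def
      uminus_bicomplex_def minus_bicomplex_def times_bicomplex_def)

text \<open>
  The ring has zero divisors, so it is not in class \<open>field\<close>; division is multiplication by the
  ring inverse of the denominator (and 0 if the denominator is not invertible).
\<close>

instantiation bicomplex :: inverse
begin

definition inverse_bicomplex :: "bicomplex \<Rightarrow> bicomplex" where
  "inverse x = (if x dvd 1 then THE y. x * y = 1 else 0)" for x :: bicomplex
definition divide_bicomplex :: "bicomplex \<Rightarrow> bicomplex \<Rightarrow> bicomplex" where
  "x div y = x * inverse y" for x y :: bicomplex

instance ..

end

lemma inverse_bicomplex_eqI:
  fixes x y :: bicomplex
  assumes "x * y = 1"
  shows "inverse x = y"
proof -
  have "x dvd 1"
    using assms by (metis dvd_triv_left)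
  moreover have "(THE z. x * z = 1) = y"
  proof (rule the_equality)
    fix z assume "x * z = 1"
    then have "z = z * (x * y)" using assms by simp
    also have "\<dots> = (x * z) * y" by (simp only: ac_simps)
    finally show "z = y" using \<open>x * z = 1\<close> by simp
  qed (rule assms)
  ultimately show ?thesis
    by (simp add: inverse_bicomplex_def)
qed

instantiation bicomplex :: real_algebra_1
begin

definition scaleR_bicomplex :: "real \<Rightarrow> bicomplex \<Rightarrow> bicomplex" where
  "scaleR r x = Bicomplex (r * bc0 x) (r * bc1 x) (r * bc2 x) (r * bc3 x)"

instance
  by standard (simp_all add: bicomplex_eq_iff scaleR_bicomplex_def algebra_simps)

end

text \<open>
  All norms on this finite-dimensional space are equivalent; the 1-norm is used because it is
  submultiplicative, so that the library exponential (the power series) is available.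
\<close>

instantiation bicomplex :: real_normed_algebra_1
begin

definition norm_bicomplex :: "bicomplex \<Rightarrow> real" where
  "norm x = \<bar>bc0 x\<bar> + \<bar>bc1 x\<bar> + \<bar>bc2 x\<bar> + \<bar>bc3 x\<bar>"
definition sgn_bicomplex :: "bicomplex \<Rightarrow> bicomplex" where
  "sgn x = x /\<^sub>R norm x" for x :: bicomplex
definition dist_bicomplex :: "bicomplex \<Rightarrow> bicomplex \<Rightarrow> real" where
  "dist x y = norm (x - y)" for x y :: bicomplex
definition uniformity_bicomplex :: "(bicomplex \<times> bicomplex) filter" where
  "uniformity = (INF e\<in>{0 <..}. principal {(x :: bicomplex, y). dist x y < e})"
definition open_bicomplex :: "bicomplex set \<Rightarrow> bool" where
  "open U \<longleftrightarrow> (\<forall>x\<in>U. eventually (\<lambda>(x', y). x' = x \<longrightarrow> y \<in> U) uniformity)" for U :: "bicomplex set"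

instance
proof
  fix r :: real and x y :: bicomplex and U :: "bicomplex set"
  show "dist x y = norm (x - y)" "sgn x = x /\<^sub>R norm x"
    by (rule dist_bicomplex_def sgn_bicomplex_def)+
  show "uniformity = (INF e\<in>{0 <..}. principal {(x, y). dist (x :: bicomplex) y < e})"
    by (rule uniformity_bicomplex_def)
  show "open U \<longleftrightarrow> (\<forall>x\<in>U. eventually (\<lambda>(x', y). x' = x \<longrightarrow> y \<in> U) uniformity)"
    by (rule open_bicomplex_def)
  show "norm x = 0 \<longleftrightarrow> x = 0"
    by (auto simp: norm_bicomplex_def bicomplex_eq_iff)
  have "norm (x + y) \<le> (\<bar>bc0 x\<bar> + \<bar>bc0 y\<bar>) + (\<bar>bc1 x\<bar> + \<bar>bc1 y\<bar>)
      + (\<bar>bc2 x\<bar> + \<bar>bc2 y\<bar>) + (\<bar>bc3 x\<bar> + \<bar>bc3 y\<bar>)"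
    unfolding norm_bicomplex_def bc_ring_simps by (intro add_mono abs_triangle_ineq)
  also have "\<dots> = norm x + norm y"
    unfolding norm_bicomplex_def by (simp only: ac_simps)
  finally show "norm (x + y) \<le> norm x + norm y" .
  show "norm (r *\<^sub>R x) = \<bar>r\<bar> * norm x"
    by (simp add: norm_bicomplex_def scaleR_bicomplex_def abs_mult algebra_simps)
  show "norm (1 :: bicomplex) = 1"
    by (simp add: norm_bicomplex_def)
  have four: "\<bar>a + b + c + d\<bar> \<le> \<bar>a\<bar> + \<bar>b\<bar> + \<bar>c\<bar> + \<bar>d\<bar>" for a b c d :: real
    by linarith
  have "norm (x * y) \<le>
      (\<bar>bc0 x * bc0 y\<bar> + \<bar>- (bc1 x * bc1 y)\<bar> + \<bar>- (bc2 x * bc2 y)\<bar> + \<bar>bc3 x * bc3 y\<bar>)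
    + (\<bar>bc0 x * bc1 y\<bar> + \<bar>bc1 x * bc0 y\<bar> + \<bar>- (bc2 x * bc3 y)\<bar> + \<bar>- (bc3 x * bc2 y)\<bar>)
    + (\<bar>bc0 x * bc2 y\<bar> + \<bar>bc2 x * bc0 y\<bar> + \<bar>- (bc1 x * bc3 y)\<bar> + \<bar>- (bc3 x * bc1 y)\<bar>)
    + (\<bar>bc0 x * bc3 y\<bar> + \<bar>bc3 x * bc0 y\<bar> + \<bar>bc1 x * bc2 y\<bar> + \<bar>bc2 x * bc1 y\<bar>)"
    unfolding norm_bicomplex_def bc_ring_simps diff_conv_add_uminus
    by (intro add_mono four)
  also have "\<dots> = norm x * norm y"
    unfolding norm_bicomplex_def abs_minus_cancel abs_mult by (simp only: algebra_simps)
  finally show "norm (x * y) \<le> norm x * norm y" .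
qed

end

lemma bc_scaleR_simps [simp]:
  "bc0 (r *\<^sub>R x) = r * bc0 x" "bc1 (r *\<^sub>R x) = r * bc1 x"
  "bc2 (r *\<^sub>R x) = r * bc2 x" "bc3 (r *\<^sub>R x) = r * bc3 x"
  by (simp_all add: scaleR_bicomplex_def)

lemma bc_of_real_simps [simp]:
  "bc0 (of_real r) = r" "bc1 (of_real r) = 0" "bc2 (of_real r) = 0" "bc3 (of_real r) = 0"
  by (simp_all add: of_real_def)

lemma bounded_linear_bc:
  "bounded_linear bc0" "bounded_linear bc1" "bounded_linear bc2" "bounded_linear bc3"
  by (rule bounded_linear_intro[where K = 1]; simp add: norm_bicomplex_def)+

instance bicomplex :: banach
proof
  fix X :: "nat \<Rightarrow> bicomplex"
  assume X: "Cauchy X"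
  note C = bounded_linear.Cauchy[OF _ X]
  obtain a b c d where
    lim: "(\<lambda>n. bc0 (X n)) \<longlonglongrightarrow> a" "(\<lambda>n. bc1 (X n)) \<longlonglongrightarrow> b"
      "(\<lambda>n. bc2 (X n)) \<longlonglongrightarrow> c" "(\<lambda>n. bc3 (X n)) \<longlonglongrightarrow> d"
    using bounded_linear_bc[THEN C, THEN Cauchy_convergent] unfolding convergent_def by blast
  have "(\<lambda>n. \<bar>bc0 (X n) - a\<bar> + \<bar>bc1 (X n) - b\<bar> + \<bar>bc2 (X n) - c\<bar> + \<bar>bc3 (X n) - d\<bar>)
      \<longlonglongrightarrow> \<bar>a - a\<bar> + \<bar>b - b\<bar> + \<bar>c - c\<bar> + \<bar>d - d\<bar>"
    by (intro tendsto_intros lim)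
  then have "(\<lambda>n. norm (X n - Bicomplex a b c d)) \<longlonglongrightarrow> 0"
    by (simp add: norm_bicomplex_def)
  then have "X \<longlonglongrightarrow> Bicomplex a b c d"
    by (simp add: LIM_zero_iff tendsto_norm_zero_iff)
  then show "convergent X"
    by (rule convergentI)
qed

definition bi1 :: bicomplex ("\<i>\<^sub>1") where "\<i>\<^sub>1 = Bicomplex 0 1 0 0"
definition bi2 :: bicomplex ("\<i>\<^sub>2") where "\<i>\<^sub>2 = Bicomplex 0 0 1 0"
definition bj :: bicomplex ("\<j>") where "\<j> = Bicomplex 0 0 0 1"

lemma unit_products:
  "\<i>\<^sub>1 * \<i>\<^sub>1 = - 1" "\<i>\<^sub>2 * \<i>\<^sub>2 = - 1" "\<j> * \<j> = 1"
  "\<i>\<^sub>1 * \<i>\<^sub>2 = \<j>" "\<i>\<^sub>2 * \<i>\<^sub>1 = \<j>" "\<i>\<^sub>1 * \<j> = - \<i>\<^sub>2" "\<j> * \<i>\<^sub>1 = - \<i>\<^sub>2"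
  "\<i>\<^sub>2 * \<j> = - \<i>\<^sub>1" "\<j> * \<i>\<^sub>2 = - \<i>\<^sub>1"
  by (simp_all add: bicomplex_eq_iff bi1_def bi2_def bj_def)

lemma bicomplex_expand:
  "Bicomplex a b c d = of_real a + of_real b * \<i>\<^sub>1 + of_real c * \<i>\<^sub>2 + of_real d * \<j>"
  by (simp add: bicomplex_eq_iff bi1_def bi2_def bj_def)

definition conj1 :: "bicomplex \<Rightarrow> bicomplex" where
  "conj1 w = Bicomplex (bc0 w) (- bc1 w) (bc2 w) (- bc3 w)"
definition conj2 :: "bicomplex \<Rightarrow> bicomplex" where
  "conj2 w = Bicomplex (bc0 w) (bc1 w) (- bc2 w) (- bc3 w)"
definition conj3 :: "bicomplex \<Rightarrow> bicomplex" where
  "conj3 w = Bicomplex (bc0 w) (- bc1 w) (- bc2 w) (bc3 w)"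

text \<open>
  Functions of \<open>(x, t)\<close> take pairs with \<open>x\<close> first. \<open>rdx\<close>, \<open>rdt\<close> are the partial derivatives of
  real-valued functions, \<open>bdx\<close>, \<open>bdt\<close> the componentwise ones of bicomplex-valued functions.
\<close>

definition rdx :: "(real \<times> real \<Rightarrow> real) \<Rightarrow> real \<times> real \<Rightarrow> real" where
  "rdx f p = deriv (\<lambda>s. f (s, snd p)) (fst p)"
definition rdt :: "(real \<times> real \<Rightarrow> real) \<Rightarrow> real \<times> real \<Rightarrow> real" where
  "rdt f p = deriv (\<lambda>s. f (fst p, s)) (snd p)"

definition bdx :: "(real \<times> real \<Rightarrow> bicomplex) \<Rightarrow> real \<times> real \<Rightarrow> bicomplex" where
  "bdx f p = Bicomplex (rdx (\<lambda>q. bc0 (f q)) p) (rdx (\<lambda>q. bc1 (f q)) p)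
                       (rdx (\<lambda>q. bc2 (f q)) p) (rdx (\<lambda>q. bc3 (f q)) p)"
definition bdt :: "(real \<times> real \<Rightarrow> bicomplex) \<Rightarrow> real \<times> real \<Rightarrow> bicomplex" where
  "bdt f p = Bicomplex (rdt (\<lambda>q. bc0 (f q)) p) (rdt (\<lambda>q. bc1 (f q)) p)
                       (rdt (\<lambda>q. bc2 (f q)) p) (rdt (\<lambda>q. bc3 (f q)) p)"

text \<open>\<open>Ck k f\<close>: all directional derivatives of \<open>f\<close> up to order \<open>k\<close> exist and are continuous.\<close>

fun Ck :: "nat \<Rightarrow> ('a::real_normed_vector \<Rightarrow> 'b::real_normed_vector) \<Rightarrow> bool" where
  "Ck 0 f \<longleftrightarrow> continuous_on UNIV f"
| "Ck (Suc k) f \<longleftrightarrow> (\<forall>p. f differentiable (at p)) \<and> (\<forall>v. Ck k (\<lambda>p. frechet_derivative f (at p) v))"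

definition smooth :: "('a::real_normed_vector \<Rightarrow> 'b::real_normed_vector) \<Rightarrow> bool" where
  "smooth f \<longleftrightarrow> (\<forall>k. Ck k f)"

end

(* Write psi = exp w with w = alpha + beta i1 + gamma i2 + delta j. The exponential turns the
   products psi psi^dagger into exponentials of sums, and each current into such an exponential
   times a derivative of the difference of the two exponents. The left-hand sides of the first two
   continuity equations are then exp(w + w^dagger1) (2 A + 2 C i2) and exp(w + w^dagger3)
   (2 A - 2 B j); as exponentials are units, they vanish exactly when the second factors do.
   The Schroedinger operator applied to psi is psi times an expression whose i1, i2 and j
   components are hbar A, hbar B and hbar C. The other two equations follow by conjugation. *)
theory Submission
  imports Defs
begin

section \<open>Partial derivatives read off from the total derivative\<close>

lemma smooth_differentiable:
  assumes "smooth f"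
  shows "f differentiable at p"
proof -
  have "Ck (Suc 0) f"
    using assms by (simp only: smooth_def)
  then show ?thesis by simp
qed

lemma smooth_frechet_derivative_differentiable:
  assumes "smooth f"
  shows "(\<lambda>p. frechet_derivative f (at p) v) differentiable at p"
proof -
  have "Ck (Suc (Suc 0)) f"
    using assms by (simp only: smooth_def)
  then show ?thesis by simp
qed

text \<open>Chain rule along the horizontal line \<open>s \<mapsto> (s, snd p)\<close>, together
  with the fact that a linear map on the reals is multiplication by its value at 1. This links
  \<open>deriv\<close>, on which \<open>rdx\<close> is built, to the calculus of
  \<open>has_derivative\<close>.\<close>

lemma rdx_eq:
  assumes "(f has_derivative F) (at p)"
  shows "rdx f p = F (1, 0)"
proof -
  interpret F: bounded_linear F
    using assms by (rule has_derivative_bounded_linear)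
  have "((\<lambda>s. (s, snd p)) has_derivative (\<lambda>h. (h, 0))) (at (fst p))"
    by (auto intro!: derivative_eq_intros)
  from has_derivative_compose[OF this, of f F] assms
  have "((\<lambda>s. f (s, snd p)) has_derivative (\<lambda>h. F (h, 0))) (at (fst p))"
    by simp
  moreover have "(\<lambda>h. F (h, 0)) = (*) (F (1, 0))"
  proof
    show "F (h, 0) = F (1, 0) * h" for h
      using F.scaleR[of h "(1, 0)"] by simp
  qed
  ultimately have "((\<lambda>s. f (s, snd p)) has_real_derivative F (1, 0)) (at (fst p))"
    by (simp only: has_field_derivative_def)
  then show ?thesis
    unfolding rdx_def by (rule DERIV_imp_deriv)
qed

lemma rdt_eq:
  assumes "(f has_derivative F) (at p)"
  shows "rdt f p = F (0, 1)"
proof -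
  interpret F: bounded_linear F
    using assms by (rule has_derivative_bounded_linear)
  have "((\<lambda>s. (fst p, s)) has_derivative (\<lambda>h. (0, h))) (at (snd p))"
    by (auto intro!: derivative_eq_intros)
  from has_derivative_compose[OF this, of f F] assms
  have "((\<lambda>s. f (fst p, s)) has_derivative (\<lambda>h. F (0, h))) (at (snd p))"
    by simp
  moreover have "(\<lambda>h. F (0, h)) = (*) (F (0, 1))"
  proof
    show "F (0, h) = F (0, 1) * h" for h
      using F.scaleR[of h "(0, 1)"] by simp
  qed
  ultimately have "((\<lambda>s. f (fst p, s)) has_real_derivative F (0, 1)) (at (snd p))"
    by (simp only: has_field_derivative_def)
  then show ?thesis
    unfolding rdt_def by (rule DERIV_imp_deriv)
qed

text \<open>For smooth \<open>f\<close>, \<open>rdx f\<close> is the directional derivative of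
  \<open>f\<close> along \<open>(1, 0)\<close>, and its differentiability is part of
  \<open>Ck 2\<close>. The second \<open>x\<close>-derivatives in the equations rest on
  this.\<close>

lemma rdx_differentiable:
  assumes "smooth f"
  shows "rdx f differentiable at p"
proof -
  have "rdx f = (\<lambda>p. frechet_derivative f (at p) (1, 0))"
    using rdx_eq smooth_differentiable[OF assms] frechet_derivative_works by blast
  then show ?thesis
    using smooth_frechet_derivative_differentiable[OF assms] by simp
qed

lemma
  assumes "f differentiable at p"
  shows rdx_cmult: "rdx (\<lambda>q. c * f q) p = c * rdx f p"
    and rdt_cmult: "rdt (\<lambda>q. c * f q) p = c * rdt f p"
proof -
  obtain F where F: "(f has_derivative F) (at p)"
    using assms unfolding differentiable_def by blast
  note D = has_derivative_mult_right[OF F, of c]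
  show "rdx (\<lambda>q. c * f q) p = c * rdx f p" "rdt (\<lambda>q. c * f q) p = c * rdt f p"
    by (simp_all add: rdx_eq[OF D] rdt_eq[OF D] rdx_eq[OF F] rdt_eq[OF F])
qed

lemma rdx_minus:
  assumes "f differentiable at p"
  shows "rdx (\<lambda>q. - f q) p = - rdx f p"
  using rdx_cmult[OF assms, of "- 1"] by simp

lemma rdx_zero: "rdx (\<lambda>q. 0) p = 0" and rdt_zero: "rdt (\<lambda>q. 0) p = 0"
  by (simp_all add: rdx_def rdt_def)

lemmas bc_has_derivative = bounded_linear_bc[THEN bounded_linear.has_derivative]

lemma bdx_eq:
  assumes "(f has_derivative F) (at p)"
  shows "bdx f p = F (1, 0)"
  unfolding bdx_def by (simp add: bc_has_derivative[OF assms, THEN rdx_eq])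

lemma bdt_eq:
  assumes "(f has_derivative F) (at p)"
  shows "bdt f p = F (0, 1)"
  unfolding bdt_def by (simp add: bc_has_derivative[OF assms, THEN rdt_eq])

lemma
  assumes "f differentiable at p" "g differentiable at p"
  shows bdx_mult: "bdx (\<lambda>q. f q * g q) p = bdx f p * g p + f p * bdx g p"
    and bdt_mult: "bdt (\<lambda>q. f q * g q) p = bdt f p * g p + f p * bdt g p"
proof -
  obtain F G where FG: "(f has_derivative F) (at p)" "(g has_derivative G) (at p)"
    using assms unfolding differentiable_def by blast
  note D = has_derivative_mult[OF FG]
  show "bdx (\<lambda>q. f q * g q) p = bdx f p * g p + f p * bdx g p"
    by (simp add: bdx_eq[OF D] FG[THEN bdx_eq])
  show "bdt (\<lambda>q. f q * g q) p = bdt f p * g p + f p * bdt g p"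
    by (simp add: bdt_eq[OF D] FG[THEN bdt_eq])
qed

text \<open>Serves both for the conjugations and for multiplication by a constant, which are bounded
  linear maps.\<close>

lemma
  assumes "bounded_linear L" "f differentiable at p"
  shows bdx_bounded_linear: "bdx (\<lambda>q. L (f q)) p = L (bdx f p)"
    and bdt_bounded_linear: "bdt (\<lambda>q. L (f q)) p = L (bdt f p)"
proof -
  obtain F where F: "(f has_derivative F) (at p)"
    using assms unfolding differentiable_def by blast
  note D = bounded_linear.has_derivative[OF assms(1) F]
  show "bdx (\<lambda>q. L (f q)) p = L (bdx f p)" "bdt (\<lambda>q. L (f q)) p = L (bdt f p)"
    by (simp_all add: bdx_eq[OF D] bdt_eq[OF D] bdx_eq[OF F] bdt_eq[OF F])
qed

section \<open>Differentiating the bicomplex exponential\<close>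

lemma exp_scaleR_has_derivative:
  fixes g :: "'a::real_normed_vector \<Rightarrow> real" and A :: "'b::{real_normed_algebra_1,banach}"
  assumes "(g has_derivative G) (at p)"
  shows "((\<lambda>q. exp (g q *\<^sub>R A)) has_derivative (\<lambda>h. G h *\<^sub>R (exp (g p *\<^sub>R A) * A))) (at p)"
  using has_derivative_compose[OF assms
      exp_scaleR_has_vector_derivative_right[of A "g p", unfolded has_vector_derivative_def]]
  by simp

text \<open>By commutativity \<open>exp\<close> splits into four exponentials, each of a real
  function times a fixed unit, and these have known derivatives. In the product rule every term
  regains the common factor \<open>exp (f p)\<close>, and what remains adds up to
  \<open>F h\<close>.\<close>

lemma bicomplex_exp_has_derivative:
  fixes f :: "'a::real_normed_vector \<Rightarrow> bicomplex"
  assumes "(f has_derivative F) (at p)"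
  shows "((\<lambda>q. exp (f q)) has_derivative (\<lambda>h. exp (f p) * F h)) (at p)"
proof -
  have split: "x = bc0 x *\<^sub>R 1 + bc1 x *\<^sub>R \<i>\<^sub>1 + bc2 x *\<^sub>R \<i>\<^sub>2 + bc3 x *\<^sub>R \<j>" for x
    by (simp add: bicomplex_eq_iff bi1_def bi2_def bj_def)
  have exp_split: "exp x = exp (bc0 x *\<^sub>R 1) * exp (bc1 x *\<^sub>R \<i>\<^sub>1) * exp (bc2 x *\<^sub>R \<i>\<^sub>2) * exp (bc3 x *\<^sub>R \<j>)"
    for x
    by (subst split[of x]) (simp only: exp_add_commuting[OF mult.commute])
  note D = bc_has_derivative[OF assms, THEN exp_scaleR_has_derivative]
  have "((\<lambda>q. exp (f q)) has_derivative
      (\<lambda>h. exp (f p) * (bc0 (F h) *\<^sub>R 1 + bc1 (F h) *\<^sub>R \<i>\<^sub>1 + bc2 (F h) *\<^sub>R \<i>\<^sub>2 + bc3 (F h) *\<^sub>R \<j>))) (at p)"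
    \<comment> \<open>Only exponentials of values of \<open>f\<close> are rewritten, so the factors
      that arise are not split again.\<close>
    unfolding exp_split[of "f _"]
    by (rule has_derivative_eq_rhs,
        rule has_derivative_mult[OF has_derivative_mult[OF has_derivative_mult[OF D(1) D(2)] D(3)] D(4)])
      (simp add: algebra_simps)
  then show ?thesis
    by (simp only: split[symmetric])
qed

lemma exp_differentiable:
  fixes f :: "'a::real_normed_vector \<Rightarrow> bicomplex"
  assumes "f differentiable at p"
  shows "(\<lambda>q. exp (f q)) differentiable at p"
  using assms bicomplex_exp_has_derivative unfolding differentiable_def by blast

lemma
  assumes "f differentiable at p"
  shows bdx_exp: "bdx (\<lambda>q. exp (f q)) p = bdx f p * exp (f p)"
    and bdt_exp: "bdt (\<lambda>q. exp (f q)) p = bdt f p * exp (f p)"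
proof -
  obtain F where F: "(f has_derivative F) (at p)"
    using assms unfolding differentiable_def by blast
  note D = bicomplex_exp_has_derivative[OF F]
  show "bdx (\<lambda>q. exp (f q)) p = bdx f p * exp (f p)" "bdt (\<lambda>q. exp (f q)) p = bdt f p * exp (f p)"
    by (simp_all add: bdx_eq[OF D] bdt_eq[OF D] bdx_eq[OF F] bdt_eq[OF F])
qed

section \<open>Conjugations as continuous ring homomorphisms\<close>

lemma bounded_linear_conj: "bounded_linear conj1" "bounded_linear conj2" "bounded_linear conj3"
  by (rule bounded_linear_intro[where K = 1];
      simp add: norm_bicomplex_def bicomplex_eq_iff conj1_def conj2_def conj3_def)+

lemma conj_mult:
  "conj1 (x * y) = conj1 x * conj1 y" "conj2 (x * y) = conj2 x * conj2 y"
  "conj3 (x * y) = conj3 x * conj3 y"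
  by (simp_all add: bicomplex_eq_iff conj1_def conj2_def conj3_def)

lemma conj_of_real: "conj1 (of_real r) = of_real r" "conj2 (of_real r) = of_real r"
  "conj3 (of_real r) = of_real r"
  by (simp_all add: bicomplex_eq_iff conj1_def conj2_def conj3_def)

text \<open>Continuity and linearity let \<open>L\<close> act on the power series term by term, and
  multiplicativity carries it inside the powers.\<close>

lemma bounded_linear_mult_hom_exp:
  fixes L :: "'a::{real_normed_algebra_1,banach} \<Rightarrow> 'b::{real_normed_algebra_1,banach}"
  assumes "bounded_linear L" "\<And>x y. L (x * y) = L x * L y" "L 1 = 1"
  shows "L (exp x) = exp (L x)"
proof -
  interpret L: bounded_linear L by fact
  have pow: "L (x ^ n) = L x ^ n" for n
    by (induction n) (simp_all add: assms)
  show ?thesis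
    unfolding exp_def by (simp add: L.suminf summable_exp_generic L.scaleR pow)
qed

lemma conj_exp: "conj1 (exp x) = exp (conj1 x)" "conj2 (exp x) = exp (conj2 x)"
  "conj3 (exp x) = exp (conj3 x)"
  by (rule bounded_linear_mult_hom_exp;
      use conj_of_real[of 1] in \<open>simp add: bounded_linear_conj conj_mult\<close>)+

section \<open>Currents and continuity expressions built from exponentials\<close>

lemma bc_numeral [simp]:
  "bc0 (numeral n) = numeral n" "bc1 (numeral n) = 0" "bc2 (numeral n) = 0" "bc3 (numeral n) = 0"
  using bc_of_real_simps[of "numeral n"] by simp_all

lemma Bicomplex_differentiable:
  fixes a b c d :: "'a::real_normed_vector \<Rightarrow> real"
  assumes "a differentiable at p" "b differentiable at p" "c differentiable at p" "d differentiable at p"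
  shows "(\<lambda>q. Bicomplex (a q) (b q) (c q) (d q)) differentiable at p"
proof -
  have "Bicomplex x y z u = x *\<^sub>R 1 + y *\<^sub>R \<i>\<^sub>1 + z *\<^sub>R \<i>\<^sub>2 + u *\<^sub>R \<j>" for x y z u
    by (simp add: bicomplex_eq_iff bi1_def bi2_def bj_def)
  then show ?thesis
    using assms by simp
qed

text \<open>The inverse of i1 is -i1. As division is defined by the ring inverse, the quotient is
  found by exhibiting an inverse of the denominator.\<close>

lemma current_prefactor:
  assumes "m \<noteq> 0"
  shows "of_real hbar / (2 * of_real m * \<i>\<^sub>1) = - (of_real (hbar / (2 * m)) * \<i>\<^sub>1)"
proof -
  have "inverse (2 * of_real m * \<i>\<^sub>1) = - (of_real (1 / (2 * m)) * \<i>\<^sub>1)"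
    using assms by (intro inverse_bicomplex_eqI) (simp add: bicomplex_eq_iff bi1_def)
  then show ?thesis
    by (simp add: divide_bicomplex_def bicomplex_eq_iff bi1_def)
qed

text \<open>In the currents the derivative of the difference of the two exponents has the form
  \<open>2 * \<i>\<^sub>1 * r\<close>, whose factor i1 cancels the one in the denominator.\<close>

lemma current_prefactor_mult:
  assumes "m \<noteq> 0"
  shows "of_real hbar / (2 * of_real m * \<i>\<^sub>1) * (e * (2 * \<i>\<^sub>1 * r)) = of_real (hbar / m) * e * r"
proof -
  \<comment> \<open>With \<open>c\<close> in place of the quotients both sides are polynomial, so
    comparing components suffices.\<close>
  define c where "c = hbar / (2 * m)"
  have c: "hbar / m = 2 * c"
    by (simp add: c_def)
  show ?thesis
    unfolding current_prefactor[OF assms] c_def[symmetric] c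
    by (simp add: bicomplex_eq_iff bi1_def algebra_simps)
qed

lemma current_exp:
  assumes "u differentiable at p" "v differentiable at p"
  shows "exp (v p) * bdx (\<lambda>q. exp (u q)) p - exp (u p) * bdx (\<lambda>q. exp (v q)) p
    = exp (u p + v p) * (bdx u p - bdx v p)"
  by (simp add: bdx_exp assms exp_add_commuting[OF mult.commute] algebra_simps)

text \<open>For density \<open>exp (s q)\<close> and current
  \<open>of_real c * exp (s q) * bdx r q\<close> both derivatives contain the factor
  \<open>exp (s p)\<close>. Pulling it out leaves an expression in \<open>s\<close> and
  \<open>r\<close> alone.\<close>

lemma continuity_exp:
  assumes "s differentiable at p" "bdx r differentiable at p"
  shows "bdt (\<lambda>q. exp (s q)) p + bdx (\<lambda>q. of_real c * exp (s q) * bdx r q) p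
    = exp (s p) * (bdt s p + of_real c * (bdx s p * bdx r p + bdx (bdx r) p))"
proof -
  have "bdx (\<lambda>q. of_real c * exp (s q) * bdx r q) p
      = of_real c * bdx (\<lambda>q. exp (s q) * bdx r q) p"
    using bdx_bounded_linear[OF bounded_linear_mult_right, of "\<lambda>q. exp (s q) * bdx r q" p "of_real c"]
    by (simp add: assms exp_differentiable mult.assoc)
  then show ?thesis
    by (simp add: bdx_exp bdt_exp bdx_mult assms exp_differentiable algebra_simps)
qed

lemma bdx_bdx_exp:
  assumes "\<And>q. w differentiable at q" "bdx w differentiable at p"
  shows "bdx (bdx (\<lambda>q. exp (w q))) p = exp (w p) * (bdx (bdx w) p + bdx w p * bdx w p)"
proof -
  have "bdx (\<lambda>q. exp (w q)) = (\<lambda>q. bdx w q * exp (w q))"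
    by (simp add: fun_eq_iff bdx_exp assms)
  then show ?thesis
    by (simp add: bdx_mult bdx_exp assms exp_differentiable algebra_simps)
qed

text \<open>Multiply by the inverse \<open>exp (- x)\<close>. In a ring with zero divisors a factor
  can be cancelled only for such a reason.\<close>

lemma exp_mult_eq_0_iff:
  fixes x y :: "'a::{real_normed_algebra_1,banach}"
  shows "exp x * y = 0 \<longleftrightarrow> y = 0"
proof
  assume "exp x * y = 0"
  then have "exp (- x) * exp x * y = 0"
    by (simp add: mult.assoc)
  then show "y = 0"
    by (simp add: exp_add_commuting[symmetric])
qed simp

theorem mainTheorem1:
  fixes hbar m :: real
    and V \<alpha> \<beta> \<gamma> \<delta> :: "real \<times> real \<Rightarrow> real"
    and \<psi> \<psi>1 \<psi>2 \<psi>3 J1 J2 J3 J4 C1 C2 C3 C4 :: "real \<times> real \<Rightarrow> bicomplex"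
    and A B C :: "real \<times> real \<Rightarrow> real"
  assumes "hbar > 0" and "m > 0"
    and "smooth \<alpha>" and "smooth \<beta>" and "smooth \<gamma>" and "smooth \<delta>"
    and "\<psi> = (\<lambda>p. exp (of_real (\<alpha> p) + of_real (\<beta> p) * \<i>\<^sub>1 + of_real (\<gamma> p) * \<i>\<^sub>2 + of_real (\<delta> p) * \<j>))"
    and "\<psi>1 = (\<lambda>p. conj1 (\<psi> p))" and "\<psi>2 = (\<lambda>p. conj2 (\<psi> p))" and "\<psi>3 = (\<lambda>p. conj3 (\<psi> p))"
    \<comment> \<open>the currents\<close>
    and "J1 = (\<lambda>p. of_real hbar / (2 * of_real m * \<i>\<^sub>1) * (\<psi>1 p * bdx \<psi> p - \<psi> p * bdx \<psi>1 p))"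
    and "J2 = (\<lambda>p. of_real hbar / (2 * of_real m * \<i>\<^sub>1) * (\<psi>3 p * bdx \<psi> p - \<psi> p * bdx \<psi>3 p))"
    and "J3 = (\<lambda>p. of_real hbar / (2 * of_real m * \<i>\<^sub>1) * (\<psi>1 p * bdx \<psi>2 p - \<psi>2 p * bdx \<psi>1 p))"
    and "J4 = (\<lambda>p. of_real hbar / (2 * of_real m * \<i>\<^sub>1) * (\<psi>3 p * bdx \<psi>2 p - \<psi>2 p * bdx \<psi>3 p))"
    \<comment> \<open>left-hand sides of the continuity equations\<close>
    and "C1 = (\<lambda>p. bdt (\<lambda>q. \<psi> q * \<psi>1 q) p + bdx J1 p)"
    and "C2 = (\<lambda>p. bdt (\<lambda>q. \<psi> q * \<psi>3 q) p + bdx J2 p)"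
    and "C3 = (\<lambda>p. bdt (\<lambda>q. \<psi>2 q * \<psi>1 q) p + bdx J3 p)"
    and "C4 = (\<lambda>p. bdt (\<lambda>q. \<psi>2 q * \<psi>3 q) p + bdx J4 p)"
    \<comment> \<open>left-hand sides of the real equations\<close>
    and "A = (\<lambda>p. rdt \<alpha> p + hbar / (2 * m) *
               (rdx (rdx \<beta>) p + 2 * (rdx \<alpha> p * rdx \<beta> p - rdx \<gamma> p * rdx \<delta> p)))"
    and "B = (\<lambda>p. - rdt \<delta> p + hbar / (2 * m) *
               (rdx (rdx \<gamma>) p + 2 * (rdx \<alpha> p * rdx \<gamma> p - rdx \<beta> p * rdx \<delta> p)))"
    and "C = (\<lambda>p. rdt \<gamma> p + hbar / (2 * m) *
               (rdx (rdx \<delta>) p + 2 * (rdx \<alpha> p * rdx \<delta> p + rdx \<beta> p * rdx \<gamma> p)))"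
  shows
    "((\<forall>p. \<i>\<^sub>1 * of_real hbar * bdt \<psi> p + of_real (hbar\<^sup>2 / (2 * m)) * bdx (bdx \<psi>) p - of_real (V p) * \<psi> p = 0)
        \<longrightarrow> (\<forall>p. C1 p = 0) \<and> (\<forall>p. C2 p = 0) \<and> (\<forall>p. C3 p = 0) \<and> (\<forall>p. C4 p = 0))
     \<and> (\<forall>p. J1 p = of_real (hbar / m) * exp (2 * (of_real (\<alpha> p) + of_real (\<gamma> p) * \<i>\<^sub>2))
                   * bdx (\<lambda>q. of_real (\<beta> q) + of_real (\<delta> q) * \<i>\<^sub>2) p)
     \<and> (\<forall>p. J2 p = of_real (hbar / m) * exp (2 * (of_real (\<alpha> p) + of_real (\<delta> p) * \<j>))
                   * bdx (\<lambda>q. of_real (\<beta> q) - of_real (\<gamma> q) * \<j>) p)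
     \<and> (\<forall>p. J3 p = of_real (hbar / m) * exp (2 * (of_real (\<alpha> p) - of_real (\<delta> p) * \<j>))
                   * bdx (\<lambda>q. of_real (\<beta> q) + of_real (\<gamma> q) * \<j>) p)
     \<and> (\<forall>p. J4 p = of_real (hbar / m) * exp (2 * (of_real (\<alpha> p) - of_real (\<gamma> p) * \<i>\<^sub>2))
                   * bdx (\<lambda>q. of_real (\<beta> q) - of_real (\<delta> q) * \<i>\<^sub>2) p)
     \<and> (\<forall>p. J4 p = conj2 (J1 p)) \<and> (\<forall>p. J3 p = conj1 (J2 p))
     \<and> (\<forall>p. C4 p = conj2 (C1 p)) \<and> (\<forall>p. C3 p = conj1 (C2 p))
     \<and> ((\<forall>p. C1 p = 0) \<longleftrightarrow> (\<forall>p. A p = 0) \<and> (\<forall>p. C p = 0))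
     \<and> ((\<forall>p. C2 p = 0) \<longleftrightarrow> (\<forall>p. A p = 0) \<and> (\<forall>p. B p = 0))
     \<and> ((\<forall>p. A p = 0) \<and> (\<forall>p. B p = 0) \<and> (\<forall>p. C p = 0)
          \<longleftrightarrow> (\<forall>p. C1 p = 0) \<and> (\<forall>p. C2 p = 0))"
proof -
  note smooth = \<open>smooth \<alpha>\<close> \<open>smooth \<beta>\<close> \<open>smooth \<gamma>\<close> \<open>smooth \<delta>\<close>
  note rdiff = smooth[THEN smooth_differentiable] smooth[THEN rdx_differentiable]
  note diff = Bicomplex_differentiable exp_differentiable rdiff
  note \<psi>_defs = assms(7-10)
  have m: "m \<noteq> 0" using \<open>m > 0\<close> by simp
  note rd = rdx_cmult rdt_cmult rdx_minus rdx_zero rdt_zero rdiff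
  note bd = bdx_def bdt_def rd
  define w where "w = (\<lambda>p. Bicomplex (\<alpha> p) (\<beta> p) (\<gamma> p) (\<delta> p))"
  \<comment> \<open>\<open>s1\<close> and \<open>s2\<close> are the sums of \<open>w\<close> with
    its first and third conjugates. The corresponding differences are 2 i1 times \<open>r1\<close>
    and 2 i1 times \<open>r2\<close>.\<close>
  define s1 r1 where "s1 = (\<lambda>p. Bicomplex (2 * \<alpha> p) 0 (2 * \<gamma> p) 0)"
    and "r1 = (\<lambda>p. Bicomplex (\<beta> p) 0 (\<delta> p) 0)"
  define s2 r2 where "s2 = (\<lambda>p. Bicomplex (2 * \<alpha> p) 0 0 (2 * \<delta> p))"
    and "r2 = (\<lambda>p. Bicomplex (\<beta> p) 0 0 (- \<gamma> p))"
  have \<psi>: "\<psi> = (\<lambda>p. exp (w p))" "\<psi>1 = (\<lambda>p. exp (conj1 (w p)))"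
      "\<psi>2 = (\<lambda>p. exp (conj2 (w p)))" "\<psi>3 = (\<lambda>p. exp (conj3 (w p)))"
    unfolding \<psi>_defs w_def by (simp_all only: conj_exp bicomplex_expand)
  have wdiff: "w differentiable at p" "(\<lambda>q. conj1 (w q)) differentiable at p"
      "(\<lambda>q. conj2 (w q)) differentiable at p" "(\<lambda>q. conj3 (w q)) differentiable at p" for p
    by (simp_all add: w_def conj1_def conj2_def conj3_def diff)
  have srdiff: "s1 differentiable at p" "s2 differentiable at p"
      "bdx w differentiable at p" "bdx r1 differentiable at p" "bdx r2 differentiable at p" for p
    by (simp_all add: s1_def s2_def w_def r1_def r2_def bdx_def[abs_def] rd diff)
  let ?k = "of_real (hbar / m) :: bicomplex"

  \<comment> \<open>Densities and closed forms of the first two currents\<close>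
  have prod: "\<psi> p * \<psi>1 p = exp (s1 p)" "\<psi> p * \<psi>3 p = exp (s2 p)" for p
    unfolding \<psi> exp_add_commuting[OF mult.commute, symmetric]
    by (simp_all add: s1_def s2_def w_def conj1_def conj3_def plus_bicomplex_def)
  have J1: "J1 p = ?k * exp (s1 p) * bdx r1 p" for p
  proof -
    have "w p + conj1 (w p) = s1 p"
      by (simp add: bicomplex_eq_iff w_def s1_def conj1_def)
    \<comment> \<open>The difference of \<open>w\<close> and its first conjugate is 2 \<beta> i1 + 2
      \<delta> j, and j = i1 i2.\<close>
    moreover have "bdx w p - bdx (\<lambda>q. conj1 (w q)) p = 2 * \<i>\<^sub>1 * bdx r1 p"
      by (simp add: bicomplex_eq_iff w_def r1_def conj1_def bi1_def bd)
    ultimately show ?thesis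
      unfolding \<open>J1 = _\<close> \<psi> current_exp[OF wdiff(1,2)]
      by (simp only: current_prefactor_mult[OF m])
  qed
  have J2: "J2 p = ?k * exp (s2 p) * bdx r2 p" for p
  proof -
    have "w p + conj3 (w p) = s2 p"
      by (simp add: bicomplex_eq_iff w_def s2_def conj3_def)
    \<comment> \<open>Here the difference is 2 \<beta> i1 + 2 \<gamma> i2, and i2 = -i1 j accounts
      for the minus sign in \<open>r2\<close>.\<close>
    moreover have "bdx w p - bdx (\<lambda>q. conj3 (w q)) p = 2 * \<i>\<^sub>1 * bdx r2 p"
      by (simp add: bicomplex_eq_iff w_def r2_def conj3_def bi1_def bd)
    ultimately show ?thesis
      unfolding \<open>J2 = _\<close> \<psi> current_exp[OF wdiff(1,4)]
      by (simp only: current_prefactor_mult[OF m])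
  qed

  \<comment> \<open>Conjugation symmetry of currents and continuity equations\<close>
  have \<psi>diff: "\<psi> differentiable at p" "\<psi>1 differentiable at p"
      "\<psi>2 differentiable at p" "\<psi>3 differentiable at p" for p
    by (simp_all add: \<psi> wdiff exp_differentiable)
  have conjs: "conj2 (conj1 z) = conj3 z" "conj1 (conj3 z) = conj2 z" for z
    by (simp_all add: conj1_def conj2_def conj3_def)
  have \<psi>conj: "conj2 (\<psi> p) = \<psi>2 p" "conj2 (\<psi>1 p) = \<psi>3 p"
      "conj1 (\<psi> p) = \<psi>1 p" "conj1 (\<psi>3 p) = \<psi>2 p" for p
    by (simp_all add: \<psi>_defs conjs)
  have bdx_conj: "conj2 (bdx \<psi> p) = bdx \<psi>2 p" "conj2 (bdx \<psi>1 p) = bdx \<psi>3 p"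
      "conj1 (bdx \<psi> p) = bdx \<psi>1 p" "conj1 (bdx \<psi>3 p) = bdx \<psi>2 p" for p
    by (simp_all add: bounded_linear_conj[THEN bdx_bounded_linear, symmetric] \<psi>diff \<psi>conj)
  note conj_diff = bounded_linear_conj[THEN bounded_linear.linear, THEN linear_diff]
  note conj_minus = bounded_linear_conj[THEN bounded_linear.linear, THEN linear_neg]
  have J4_conj: "J4 p = conj2 (J1 p)" and J3_conj: "J3 p = conj1 (J2 p)" for p
  proof -
    \<comment> \<open>\<open>conj2\<close> fixes the prefactor of the currents, while
      \<open>conj1\<close> negates it. The sign in the second case is absorbed by exchanging the two
      terms of the difference.\<close>
    have "conj2 \<i>\<^sub>1 = \<i>\<^sub>1" "conj1 \<i>\<^sub>1 = - \<i>\<^sub>1"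
      by (simp_all add: bicomplex_eq_iff conj1_def conj2_def bi1_def)
    then show "J4 p = conj2 (J1 p)" "J3 p = conj1 (J2 p)"
      unfolding \<open>J1 = _\<close> \<open>J2 = _\<close> \<open>J3 = _\<close> \<open>J4 = _\<close> current_prefactor[OF m]
      by (simp_all add: conj_mult conj_of_real conj_diff conj_minus bdx_conj \<psi>conj algebra_simps)
  qed
  \<comment> \<open>Differentiability of the currents comes from their closed forms. It allows a
    conjugation to pass through \<open>bdx J1\<close> and \<open>bdx J2\<close>.\<close>
  have Jdiff: "J1 differentiable at p" "J2 differentiable at p" for p
    unfolding J1[abs_def] J2[abs_def] by (simp_all add: srdiff exp_differentiable)
  have C4_conj: "C4 p = conj2 (C1 p)" and C3_conj: "C3 p = conj1 (C2 p)" for p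
  proof -
    note lin = bounded_linear_conj[THEN bounded_linear.linear, THEN linear_add]
      bounded_linear_conj[THEN bdx_bounded_linear, symmetric]
      bounded_linear_conj[THEN bdt_bounded_linear, symmetric]
    show "C4 p = conj2 (C1 p)" "C3 p = conj1 (C2 p)"
      unfolding \<open>C1 = _\<close> \<open>C2 = _\<close> \<open>C3 = _\<close> \<open>C4 = _\<close>
      by (simp_all add: lin Jdiff \<psi>diff conj_mult \<psi>conj J4_conj[symmetric] J3_conj[symmetric] mult.commute)
  qed

  have J3: "J3 p = ?k * exp (conj1 (s2 p)) * conj1 (bdx r2 p)"
    and J4: "J4 p = ?k * exp (conj2 (s1 p)) * conj2 (bdx r1 p)" for p
    by (simp_all only: J3_conj J4_conj J1 J2 conj_mult conj_of_real conj_exp)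

  \<comment> \<open>Continuity equations as real equations\<close>
  have C1: "C1 p = exp (s1 p) * Bicomplex (2 * A p) 0 (2 * C p) 0" for p
  proof -
    have "C1 p = exp (s1 p) * (bdt s1 p + ?k * (bdx s1 p * bdx r1 p + bdx (bdx r1) p))"
      unfolding \<open>C1 = _\<close> prod J1[abs_def] by (rule continuity_exp[OF srdiff(1,4)])
    \<comment> \<open>The product of \<open>bdx s1 p\<close> and \<open>bdx r1 p\<close> has no i1
      or j component. Its real and i2 components supply the quadratic terms of \<open>A\<close> and
      \<open>C\<close>.\<close>
    also have "bdt s1 p + ?k * (bdx s1 p * bdx r1 p + bdx (bdx r1) p)
        = Bicomplex (2 * A p) 0 (2 * C p) 0"
      unfolding \<open>A = _\<close> \<open>C = _\<close>
      by (simp add: bicomplex_eq_iff s1_def r1_def bd)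
    finally show ?thesis .
  qed
  have C2: "C2 p = exp (s2 p) * Bicomplex (2 * A p) 0 0 (- 2 * B p)" for p
  proof -
    have "C2 p = exp (s2 p) * (bdt s2 p + ?k * (bdx s2 p * bdx r2 p + bdx (bdx r2) p))"
      unfolding \<open>C2 = _\<close> prod J2[abs_def] by (rule continuity_exp[OF srdiff(2,5)])
    also have "bdt s2 p + ?k * (bdx s2 p * bdx r2 p + bdx (bdx r2) p)
        = Bicomplex (2 * A p) 0 0 (- 2 * B p)"
      unfolding \<open>A = _\<close> \<open>B = _\<close>
      by (simp add: bicomplex_eq_iff s2_def r2_def bd) (simp add: m field_simps)
    finally show ?thesis .
  qed
  have C1_iff: "C1 p = 0 \<longleftrightarrow> A p = 0 \<and> C p = 0" for p
    unfolding C1 exp_mult_eq_0_iff by (simp add: bicomplex_eq_iff)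
  have C2_iff: "C2 p = 0 \<longleftrightarrow> A p = 0 \<and> B p = 0" for p
    unfolding C2 exp_mult_eq_0_iff by (simp add: bicomplex_eq_iff)

  \<comment> \<open>Consequences of the Schroedinger equation\<close>
  have schroedinger: "A p = 0 \<and> B p = 0 \<and> C p = 0"
    if "\<i>\<^sub>1 * of_real hbar * bdt \<psi> p + of_real (hbar\<^sup>2 / (2 * m)) * bdx (bdx \<psi>) p - of_real (V p) * \<psi> p = 0"
    for p
  proof -
    define X where "X = \<i>\<^sub>1 * of_real hbar * bdt w p
      + of_real (hbar\<^sup>2 / (2 * m)) * (bdx (bdx w) p + bdx w p * bdx w p) - of_real (V p)"
    have "exp (w p) * X = 0"
      using that unfolding \<psi> bdx_bdx_exp[OF wdiff(1) srdiff(3)] bdt_exp[OF wdiff(1)]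
      by (simp add: X_def algebra_simps)
    then have "X = 0"
      by (simp only: exp_mult_eq_0_iff)
    \<comment> \<open>The potential is real and enters only \<open>bc0 X\<close>, so it is absent
      from these three components. Multiplication by i1 moves the time derivatives of \<alpha>,
      \<delta> and \<gamma> into them, with a minus sign at \<delta> because i1 j = -i2.\<close>
    moreover have "bc1 X = hbar * A p" "bc2 X = hbar * B p" "bc3 X = hbar * C p"
      unfolding \<open>A = _\<close> \<open>B = _\<close> \<open>C = _\<close> X_def
      using m by (simp_all add: w_def bi1_def bd field_simps power2_eq_square)
    ultimately show ?thesis
      using \<open>hbar > 0\<close> by simp
  qed
  have conj_0: "conj1 0 = 0" "conj2 0 = 0"
    by (simp_all add: bicomplex_eq_iff conj1_def conj2_def)

  have part1: "(\<forall>p. C1 p = 0) \<and> (\<forall>p. C2 p = 0) \<and> (\<forall>p. C3 p = 0) \<and> (\<forall>p. C4 p = 0)"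
    if "\<forall>p. \<i>\<^sub>1 * of_real hbar * bdt \<psi> p + of_real (hbar\<^sup>2 / (2 * m)) * bdx (bdx \<psi>) p - of_real (V p) * \<psi> p = 0"
  proof -
    have "C1 p = 0" "C2 p = 0" for p
      using that schroedinger C1_iff C2_iff by blast+
    then show ?thesis
      by (simp add: C3_conj C4_conj conj_0)
  qed

  \<comment> \<open>Matching the closed forms with the displayed formulas\<close>
  have s_exp: "2 * (of_real (\<alpha> p) + of_real (\<gamma> p) * \<i>\<^sub>2) = s1 p"
      "2 * (of_real (\<alpha> p) + of_real (\<delta> p) * \<j>) = s2 p"
      "2 * (of_real (\<alpha> p) - of_real (\<delta> p) * \<j>) = conj1 (s2 p)"
      "2 * (of_real (\<alpha> p) - of_real (\<gamma> p) * \<i>\<^sub>2) = conj2 (s1 p)" for p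
    by (simp_all add: bicomplex_eq_iff s1_def s2_def conj1_def conj2_def bi2_def bj_def)
  \<comment> \<open>The last two cases use that \<open>conj1\<close> changes the sign of j and
    \<open>conj2\<close> that of i2.\<close>
  have r_exp: "bdx (\<lambda>q. of_real (\<beta> q) + of_real (\<delta> q) * \<i>\<^sub>2) p = bdx r1 p"
      "bdx (\<lambda>q. of_real (\<beta> q) - of_real (\<gamma> q) * \<j>) p = bdx r2 p"
      "bdx (\<lambda>q. of_real (\<beta> q) + of_real (\<gamma> q) * \<j>) p = conj1 (bdx r2 p)"
      "bdx (\<lambda>q. of_real (\<beta> q) - of_real (\<delta> q) * \<i>\<^sub>2) p = conj2 (bdx r1 p)" for p
    by (simp_all add: bicomplex_eq_iff r1_def r2_def conj1_def conj2_def bi2_def bj_def bd)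

  \<comment> \<open>\<open>C1_iff\<close> and \<open>C2_iff\<close> hold at each point, so
    quantifying over \<open>p\<close> yields all the equivalences of the second part.\<close>
  show ?thesis
    unfolding s_exp r_exp
    using part1 J1 J2 J3 J4 J3_conj J4_conj C3_conj C4_conj C1_iff C2_iff by blast
qed

end
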